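(* Let $0<q<1$, $a>0$, $\alpha\in\mathbb{R}$, and for $x>0$ let $$H_\alpha(x)=\log\left[\left(\frac{1-q^x}{1-q^{x+a}}\right)^\alpha\frac{\Gamma_q(x)}{\Gamma_q(x+a)}\exp\left(\sum_{k=1}^\infty\frac{q^{kx}-q^{k(x+a)}}{k^2\log q}\right)\right].$$ Then $-H_\alpha'(x)$ is completely monotonic on $(0,\infty)$ for $\alpha\le 1/2$, and $H_\alpha'(x)$ is completely monotonic on $(0,\infty)$ for $\alpha\ge 1$.
   Context: For $0<q<1$ the $q$-gamma function is $\Gamma_q(x)=(1-q)^{1-x}\prod_{n=0}^\infty \frac{1-q^{n+1}}{1-q^{n+x}}$. A function $f$ is completely monotonic on an interval $I$ if it has derivatives of all orders on $I$ and $(-1)^n f^{(n)}(x)\ge 0$ for all $x\in I$ and all $n=0,1,2,\dots$. *)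

theory Defs
  imports "HOL-Analysis.Analysis"
begin

definition q_Gamma :: "real \<Rightarrow> real \<Rightarrow> real" where
  "q_Gamma q x = (1 - q) powr (1 - x) * (\<Prod>n. (1 - q ^ (n + 1)) / (1 - q powr (real n + x)))"

text \<open>
  \<open>D n\<close> is the \<open>n\<close>-th derivative of \<open>f\<close> on the interval \<open>I\<close>. It is uniquely determined on a
  non-degenerate interval; at an endpoint belonging to \<open>I\<close> the derivatives are one-sided, and
  on an open interval they are the ordinary ones.
\<close>

definition completely_monotonic_on :: "real set \<Rightarrow> (real \<Rightarrow> real) \<Rightarrow> bool" where
  "completely_monotonic_on I f \<longleftrightarrow>
     (\<exists>D :: nat \<Rightarrow> real \<Rightarrow> real.
        (\<forall>x\<in>I. D 0 x = f x) \<and>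
        (\<forall>n. \<forall>x\<in>I. (D n has_real_derivative D (Suc n) x) (at x within I)) \<and>
        (\<forall>n. \<forall>x\<in>I. (- 1) ^ n * D n x \<ge> 0))"

text \<open>The series over \<open>k \<ge> 1\<close> is indexed by \<open>Suc k\<close>.\<close>

definition H :: "real \<Rightarrow> real \<Rightarrow> real \<Rightarrow> real \<Rightarrow> real" where
  "H q a \<alpha> x =
     ln (((1 - q powr x) / (1 - q powr (x + a))) powr \<alpha>
         * (q_Gamma q x / q_Gamma q (x + a))
         * exp (\<Sum>k. (q powr (real (Suc k) * x) - q powr (real (Suc k) * (x + a)))
                     / ((real (Suc k))\<^sup>2 * ln q)))"

end

theory Submission
  imports Defs
begin

text \<open>
  Expanding logarithms, \<open>H q a \<alpha> x = a * ln (1 - q) + (\<Sum>k. c k * (q powr x) ^ k)\<close>, where \<open>c 0 = 0\<close> and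
  \<open>c k = (1 - q powr (k * a)) / k * (1 / (1 - q ^ k) + 1 / (k * ln q) - \<alpha>)\<close> for \<open>k \<ge> 1\<close>.
  With \<open>t = - k * ln q > 0\<close> the last factor is \<open>1 / (1 - exp (- t)) - 1 / t - \<alpha>\<close>, and
  \<open>1 / (1 - exp (- t)) - 1 / t\<close> lies between \<open>1 / 2\<close> and \<open>1\<close>. So all \<open>c k\<close> have the same sign
  when \<open>\<alpha> \<le> 1 / 2\<close> or \<open>\<alpha> \<ge> 1\<close>, and differentiating termwise multiplies \<open>c k\<close> by
  \<open>k * ln q \<le> 0\<close>, which gives the alternating signs of the derivatives.
\<close>

section \<open>Power series on the unit disc\<close>

definition powser_conv :: "(nat \<Rightarrow> real) \<Rightarrow> bool" where
  "powser_conv c \<longleftrightarrow> (\<forall>y. \<bar>y\<bar> < 1 \<longrightarrow> summable (\<lambda>k. c k * y ^ k))"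

text \<open>Each term is a multiple of \<open>exp (k * x * ln q)\<close>, so differentiation in
  \<open>x\<close> only rescales the coefficients and stays within this family.\<close>

definition exp_ser :: "real \<Rightarrow> (nat \<Rightarrow> real) \<Rightarrow> real \<Rightarrow> real" where
  "exp_ser q c x = (\<Sum>k. c k * (q powr x) ^ k)"

text \<open>At \<open>k = 0\<close> the three coefficient sequences below vanish, because division by zero gives zero.\<close>

definition log_coeff :: "nat \<Rightarrow> real" where
  "log_coeff k = 1 / real k"

definition gamma_coeff :: "real \<Rightarrow> nat \<Rightarrow> real" where
  "gamma_coeff q k = 1 / (real k * (1 - q ^ k))"

definition dilog_coeff :: "real \<Rightarrow> nat \<Rightarrow> real" where
  "dilog_coeff q k = 1 / ((real k)\<^sup>2 * ln q)"

text \<open>The factor with \<open>q powr a\<close> comes from subtracting the shift by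
  \<open>a\<close>; \<open>\<alpha>\<close> enters negatively because \<open>ln (1 - y)\<close> has
  coefficients \<open>- 1 / k\<close>.\<close>

definition H_coeff :: "real \<Rightarrow> real \<Rightarrow> real \<Rightarrow> nat \<Rightarrow> real" where
  "H_coeff q a \<alpha> k = (1 - (q powr a) ^ k) * (gamma_coeff q k + dilog_coeff q k - \<alpha> * log_coeff k)"

lemma powser_conv_bounded:
  assumes "\<And>k. \<bar>c k\<bar> \<le> C"
  shows "powser_conv c"
  unfolding powser_conv_def
proof (intro allI impI)
  fix y :: real assume y: "\<bar>y\<bar> < 1"
  have "summable (\<lambda>k. C * \<bar>y\<bar> ^ k)"
    using y by (intro summable_mult summable_geometric) auto
  moreover have "norm (c k * y ^ k) \<le> C * \<bar>y\<bar> ^ k" for k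
    using assms[of k] by (simp add: abs_mult power_abs mult_right_mono)
  ultimately show "summable (\<lambda>k. c k * y ^ k)"
    by (rule summable_comparison_test'[where N = 0])
qed

text \<open>Up to a factor \<open>y\<close> this is the formal derivative. Boundedness of
  coefficients would not survive it, convergence on the unit disc does; hence the form of
  \<open>powser_conv\<close>.\<close>

lemma powser_conv_index_mult:
  assumes "powser_conv c"
  shows "powser_conv (\<lambda>k. real k * c k)"
  unfolding powser_conv_def
proof (intro allI impI)
  fix y :: real assume y: "\<bar>y\<bar> < 1"
  have "summable (\<lambda>k. diffs c k * y ^ k)"
    using assms y by (intro termdiff_converges[where K = 1]) (auto simp: powser_conv_def)
  then have "summable (\<lambda>k. y * (diffs c k * y ^ k))"
    by (rule summable_mult)
  then have "summable (\<lambda>k. real (Suc k) * c (Suc k) * y ^ Suc k)"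
    by (simp add: diffs_def mult_ac)
  then show "summable (\<lambda>k. real k * c k * y ^ k)"
    by (subst (asm) summable_Suc_iff)
qed

lemma powser_conv_cmult:
  assumes "powser_conv c"
  shows "powser_conv (\<lambda>k. b * c k)"
  using assms unfolding powser_conv_def by (simp add: mult.assoc summable_mult)

lemma powser_conv_power_mult:
  assumes "powser_conv c"
  shows "powser_conv (\<lambda>k. (real k * b) ^ n * c k)"
proof (induction n)
  case 0
  then show ?case using assms by simp
next
  case (Suc n)
  from powser_conv_cmult[OF powser_conv_index_mult[OF this], of b]
  show ?case by (simp add: mult_ac)
qed

section \<open>Series in powers of \<open>q powr x\<close>: derivatives, complete monotonicity,
  limits and shifts\<close>

context
  fixes q :: real
  assumes q0: "0 < q" and q1: "q < 1"
begin

lemma q_powr_less_one: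
  "x > 0 \<Longrightarrow> q powr x < 1"
  by (simp add: powr01_less_one q0 q1)

lemma exp_ser_sums:
  assumes "powser_conv c" "x > 0"
  shows "(\<lambda>k. c k * (q powr x) ^ k) sums exp_ser q c x"
  using assms q_powr_less_one[of x] unfolding powser_conv_def exp_ser_def
  by (intro summable_sums) auto

lemma exp_ser_has_derivative:
  assumes c: "powser_conv c" and x: "x > 0"
  shows "(exp_ser q c has_real_derivative exp_ser q (\<lambda>k. real k * ln q * c k) x) (at x)"
proof -
  define y where "y = q powr x"
  have y: "norm y < 1"
    using q_powr_less_one[OF x] by (simp add: y_def)
  have sm: "summable (\<lambda>k. c k * z ^ k)" if "norm z < 1" for z :: real
    using c that by (simp add: powser_conv_def)
  have D: "((\<lambda>z. \<Sum>k. c k * z ^ k) has_real_derivative (\<Sum>k. diffs c k * y ^ k)) (at y)"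
    by (rule termdiffs_strong'[OF sm y])
  have E: "((\<lambda>x. q powr x) has_real_derivative y * ln q) (at x)"
    unfolding y_def using q0 by (auto intro!: derivative_eq_intros)
  have "(\<lambda>k. diffs c k * y ^ k) sums (\<Sum>k. diffs c k * y ^ k)"
    by (intro summable_sums termdiff_converges[OF y sm])
  \<comment> \<open>The chain rule factor \<open>y\<close> restores the exponent that
    differentiation lowers; the vanishing term at \<open>k = 0\<close> then lets the index start
    from 0 again.\<close>
  then have "(\<lambda>k. (y * ln q) * (diffs c k * y ^ k)) sums ((y * ln q) * (\<Sum>k. diffs c k * y ^ k))"
    by (rule sums_mult)
  then have "(\<lambda>k. real (Suc k) * ln q * c (Suc k) * y ^ Suc k)
               sums ((y * ln q) * (\<Sum>k. diffs c k * y ^ k))"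
    by (simp add: diffs_def mult_ac)
  then have "(\<lambda>k. real k * ln q * c k * y ^ k) sums ((y * ln q) * (\<Sum>k. diffs c k * y ^ k))"
    by (subst (asm) sums_Suc_iff) simp
  then have eq: "exp_ser q (\<lambda>k. real k * ln q * c k) x = (\<Sum>k. diffs c k * y ^ k) * (y * ln q)"
    unfolding exp_ser_def y_def[symmetric] by (simp add: sums_iff mult_ac)
  show ?thesis
    unfolding eq using DERIV_chain2[OF D[unfolded y_def] E[unfolded y_def]]
    by (simp add: exp_ser_def[abs_def] y_def)
qed

text \<open>The easy half of Bernstein's theorem for a discrete measure: since
  \<open>ln q < 0\<close>, the sign \<open>(- 1) ^ n\<close> turns \<open>(k * ln q) ^ n\<close>
  into a power of a nonnegative number, term by term.\<close>

lemma completely_monotonic_exp_ser: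
  assumes c: "powser_conv c" and nonneg: "\<And>k. c k \<ge> 0"
    and f: "\<And>x. x > 0 \<Longrightarrow> f x = exp_ser q c x"
  shows "completely_monotonic_on {0<..} f"
  unfolding completely_monotonic_on_def
proof (intro exI[of _ "\<lambda>n. exp_ser q (\<lambda>k. (real k * ln q) ^ n * c k)"] conjI allI ballI)
  fix x :: real assume "x \<in> {0<..}"
  then have x: "x > 0" by simp
  show "exp_ser q (\<lambda>k. (real k * ln q) ^ 0 * c k) x = f x"
    using f[OF x] by simp
  fix n
  have conv: "powser_conv (\<lambda>k. (real k * ln q) ^ n * c k)"
    by (rule powser_conv_power_mult[OF c])
  show "(exp_ser q (\<lambda>k. (real k * ln q) ^ n * c k) has_real_derivative
         exp_ser q (\<lambda>k. (real k * ln q) ^ Suc n * c k) x) (at x within {0<..})"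
    using exp_ser_has_derivative[OF conv x]
    by (simp add: mult.assoc has_field_derivative_at_within)
  have sums: "(\<lambda>k. (- 1) ^ n * ((real k * ln q) ^ n * c k * (q powr x) ^ k))
          sums ((- 1) ^ n * exp_ser q (\<lambda>k. (real k * ln q) ^ n * c k) x)"
    by (rule sums_mult[OF exp_ser_sums[OF conv x]])
  have "0 \<le> (- 1) ^ n * ((real k * ln q) ^ n * c k * (q powr x) ^ k)" for k
  proof -
    have "0 \<le> (real k * - ln q) ^ n * c k * (q powr x) ^ k"
      using q0 q1 nonneg[of k] by (intro mult_nonneg_nonneg zero_le_power) auto
    also have "(real k * - ln q) ^ n = (- 1) ^ n * (real k * ln q) ^ n"
      by (simp flip: power_mult_distrib)
    finally show ?thesis by (simp only: mult.assoc)
  qed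
  then show "0 \<le> (- 1) ^ n * exp_ser q (\<lambda>k. (real k * ln q) ^ n * c k) x"
    by (rule sums_le[OF _ sums_zero sums])
qed

text \<open>The points \<open>q powr (n + x)\<close> tend to 0, where the power series is
  continuous. This supplies the limit for telescoping.\<close>

lemma exp_ser_tendsto:
  assumes c: "powser_conv c" and x: "x > 0"
  shows "(\<lambda>n. exp_ser q c (real n + x)) \<longlonglongrightarrow> c 0"
proof -
  have "((\<lambda>z. \<Sum>k. c k * z ^ k) has_real_derivative (\<Sum>k. diffs c k * 0 ^ k)) (at 0)"
    using c by (intro termdiffs_strong'[where K = 1]) (auto simp: powser_conv_def)
  then have "isCont (\<lambda>z. \<Sum>k. c k * z ^ k) 0"
    by (rule DERIV_isCont)
  moreover have "(\<lambda>n. q powr (real n + x)) \<longlonglongrightarrow> 0"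
  proof -
    have "(\<lambda>n. q ^ n * q powr x) \<longlonglongrightarrow> 0 * q powr x"
      using q0 q1 by (intro tendsto_mult LIMSEQ_realpow_zero tendsto_const) auto
    then show ?thesis using q0 by (simp add: powr_add powr_realpow)
  qed
  ultimately have "(\<lambda>n. \<Sum>k. c k * (q powr (real n + x)) ^ k) \<longlonglongrightarrow> (\<Sum>k. c k * 0 ^ k)"
    by (rule isCont_tendsto_compose)
  then show ?thesis by (simp add: exp_ser_def)
qed

lemma powr_add_power:
  "(q powr (x + a)) ^ k = (q powr a) ^ k * (q powr x) ^ k"
  by (simp add: powr_add power_mult_distrib mult.commute)

text \<open>The shift multiplies the \<open>k\<close>-th coefficient by
  \<open>(q powr a) ^ k\<close>. Shift 1 serves the functional equation behind the q-gamma function,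
  shift \<open>a\<close> serves \<open>H\<close>.\<close>

lemma exp_ser_shift_diff:
  assumes c: "powser_conv c" and x: "x > 0" and a: "a > 0"
  shows "(\<lambda>k. (1 - (q powr a) ^ k) * c k * (q powr x) ^ k) sums (exp_ser q c x - exp_ser q c (x + a))"
proof -
  have "(\<lambda>k. c k * (q powr x) ^ k - c k * (q powr (x + a)) ^ k)
           sums (exp_ser q c x - exp_ser q c (x + a))"
    using x a by (intro sums_diff exp_ser_sums c) auto
  then show ?thesis by (simp add: powr_add_power algebra_simps)
qed

section \<open>Expansions of the logarithm, the q-gamma function and the dilogarithm term\<close>

lemma powser_conv_log: "powser_conv log_coeff"
proof (rule powser_conv_bounded)
  fix k show "\<bar>log_coeff k\<bar> \<le> 1"
    by (cases k) (auto simp: log_coeff_def)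
qed

lemma powser_conv_gamma: "powser_conv (gamma_coeff q)"
proof (rule powser_conv_bounded)
  fix k show "\<bar>gamma_coeff q k\<bar> \<le> 1 / (1 - q)"
  proof (cases k)
    case 0
    then show ?thesis using q1 by (simp add: gamma_coeff_def)
  next
    case (Suc m)
    \<comment> \<open>Over \<open>k \<ge> 1\<close> both factors of the denominator are smallest at
      \<open>k = 1\<close>, whence the bound \<open>1 / (1 - q)\<close>.\<close>
    have "q ^ k \<le> q" using q0 q1 power_decreasing[of 1 k q] Suc by simp
    then have "1 * (1 - q) \<le> real k * (1 - q ^ k)"
      using q1 Suc by (intro mult_mono) auto
    moreover have "0 < 1 - q" using q1 by simp
    ultimately show ?thesis
      by (simp add: gamma_coeff_def frac_le)
  qed
qed

lemma powser_conv_dilog: "powser_conv (dilog_coeff q)"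
proof (rule powser_conv_bounded)
  fix k show "\<bar>dilog_coeff q k\<bar> \<le> 1 / \<bar>ln q\<bar>"
  proof (cases k)
    case 0
    then show ?thesis by (simp add: dilog_coeff_def)
  next
    case (Suc m)
    have "1 * \<bar>ln q\<bar> \<le> (real k)\<^sup>2 * \<bar>ln q\<bar>"
      using Suc by (intro mult_right_mono) auto
    moreover have "0 < \<bar>ln q\<bar>" using q0 q1 by simp
    ultimately show ?thesis
      by (simp add: dilog_coeff_def abs_mult frac_le)
  qed
qed

lemma exp_ser_log:
  assumes "x > 0"
  shows "exp_ser q log_coeff x = - ln (1 - q powr x)"
proof -
  \<comment> \<open>Mercator series at \<open>- (q powr x)\<close>; its term at \<open>k = 0\<close>
    is a division by zero, hence 0, as in \<open>log_coeff\<close>.\<close>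
  have "(\<lambda>k. - ((- (- (q powr x))) ^ k) / of_nat k) sums ln (1 + - (q powr x))"
    using q_powr_less_one[OF assms] by (intro ln_series') auto
  from sums_minus[OF this] show ?thesis
    by (simp add: exp_ser_def log_coeff_def sums_iff)
qed

text \<open>
  The functional equation telescopes the infinite product in \<open>q_Gamma\<close>, so that no
  double series has to be rearranged.
\<close>

lemma exp_ser_gamma_step:
  assumes x: "x > 0"
  shows "exp_ser q (gamma_coeff q) x - exp_ser q (gamma_coeff q) (x + 1) = - ln (1 - q powr x)"
proof -
  \<comment> \<open>The shift by 1 produces exactly the factor \<open>1 - q ^ k\<close> that cancels
    the denominator and leaves the logarithm.\<close>
  have eq: "(1 - (q powr 1) ^ k) * gamma_coeff q k = log_coeff k" for k
  proof (cases "k = 0")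
    case False
    then have "q ^ k < 1" using q0 q1 by (simp add: power_less_one_iff)
    then show ?thesis using q0 False by (simp add: gamma_coeff_def log_coeff_def field_simps)
  qed (simp add: gamma_coeff_def log_coeff_def)
  have "(\<lambda>k. log_coeff k * (q powr x) ^ k)
          sums (exp_ser q (gamma_coeff q) x - exp_ser q (gamma_coeff q) (x + 1))"
    using exp_ser_shift_diff[OF powser_conv_gamma x, of 1] by (simp only: eq zero_less_one)
  from sums_unique2[OF this exp_ser_sums[OF powser_conv_log x]] show ?thesis
    using exp_ser_log[OF x] by simp
qed

lemma ln_factor_sums:
  assumes x: "x > 0"
  shows "(\<lambda>n. - ln (1 - q powr (real n + x))) sums exp_ser q (gamma_coeff q) x"
proof -
  \<comment> \<open>The limit subtracted by telescoping is \<open>gamma_coeff q 0\<close>, which is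
    0 by the division convention.\<close>
  have "(\<lambda>n. exp_ser q (gamma_coeff q) (real n + x) - exp_ser q (gamma_coeff q) (real (Suc n) + x))
          sums (exp_ser q (gamma_coeff q) (real 0 + x) - gamma_coeff q 0)"
    by (rule telescope_sums'[OF exp_ser_tendsto[OF powser_conv_gamma x]])
  moreover have "exp_ser q (gamma_coeff q) (real n + x) - exp_ser q (gamma_coeff q) (real (Suc n) + x)
      = - ln (1 - q powr (real n + x))" for n
    using exp_ser_gamma_step[of "real n + x"] x by (simp add: add_ac)
  ultimately show ?thesis by (simp add: gamma_coeff_def)
qed

text \<open>The numerators of the product are its denominators at \<open>x = 1\<close>, so the
  logarithm of the product is a difference of two telescoped sums.\<close>

lemma q_Gamma_eq_exp:
  assumes x: "x > 0"
  shows "q_Gamma q x =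
    exp ((1 - x) * ln (1 - q) + exp_ser q (gamma_coeff q) x - exp_ser q (gamma_coeff q) 1)"
proof -
  have S: "(\<lambda>n. - ln (1 - q powr (real n + x)) - - ln (1 - q powr (real n + 1)))
          sums (exp_ser q (gamma_coeff q) x - exp_ser q (gamma_coeff q) 1)"
    by (intro sums_diff ln_factor_sums x) auto
  have "(1 - q ^ (n + 1)) / (1 - q powr (real n + x))
      = exp (- ln (1 - q powr (real n + x)) - - ln (1 - q powr (real n + 1)))" for n
  proof -
    have "q powr (real n + x) < 1" "q powr (real n + 1) < 1"
      using x by (auto intro!: q_powr_less_one add_nonneg_pos)
    moreover have "q powr (real n + 1) = q ^ (n + 1)"
      using q0 by (simp add: powr_add powr_realpow)
    ultimately show ?thesis by (simp add: exp_diff exp_minus field_simps)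
  qed
  then have "(\<Prod>n. (1 - q ^ (n + 1)) / (1 - q powr (real n + x)))
      = exp (exp_ser q (gamma_coeff q) x - exp_ser q (gamma_coeff q) 1)"
    using prodinf_exp[OF sums_summable[OF S]] S by (simp add: sums_iff)
  moreover have "(1 - q) powr (1 - x) = exp ((1 - x) * ln (1 - q))"
    using q1 by (simp add: powr_def)
  ultimately show ?thesis
    unfolding q_Gamma_def by (simp only: exp_add[symmetric] add_diff_eq)
qed

text \<open>Up to \<open>1 / ln q\<close> the two series are dilogarithms of \<open>q powr x\<close>
  and \<open>q powr (x + a)\<close>. Starting at index 0 instead of 1 is harmless since the
  coefficient there vanishes.\<close>

lemma dilog_series_eq:
  assumes x: "x > 0" and a: "a > 0"
  shows "(\<Sum>k. (q powr (real (Suc k) * x) - q powr (real (Suc k) * (x + a)))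
                     / ((real (Suc k))\<^sup>2 * ln q))
    = exp_ser q (dilog_coeff q) x - exp_ser q (dilog_coeff q) (x + a)"
proof -
  define f where "f k = dilog_coeff q k * (q powr x) ^ k - dilog_coeff q k * (q powr (x + a)) ^ k" for k
  have "f sums (exp_ser q (dilog_coeff q) x - exp_ser q (dilog_coeff q) (x + a))"
    unfolding f_def using x a by (intro sums_diff exp_ser_sums powser_conv_dilog) auto
  then have "(\<lambda>k. f (Suc k)) sums (exp_ser q (dilog_coeff q) x - exp_ser q (dilog_coeff q) (x + a))"
    by (subst sums_Suc_iff) (simp add: f_def dilog_coeff_def)
  moreover have "q powr (real k * z) = (q powr z) ^ k" for k z
    using q0 by (simp add: powr_powr mult.commute flip: powr_realpow)
  then have "f (Suc k) = (q powr (real (Suc k) * x) - q powr (real (Suc k) * (x + a)))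
                     / ((real (Suc k))\<^sup>2 * ln q)" for k
    unfolding f_def dilog_coeff_def by (simp only: diff_divide_distrib) simp
  ultimately show ?thesis by (simp add: sums_iff)
qed

section \<open>Expansion and derivative of \<open>H\<close>\<close>

lemma H_coeff_sums:
  assumes x: "x > 0" and a: "a > 0"
  shows "(\<lambda>k. H_coeff q a \<alpha> k * (q powr x) ^ k) sums
    (exp_ser q (gamma_coeff q) x - exp_ser q (gamma_coeff q) (x + a)
     + (exp_ser q (dilog_coeff q) x - exp_ser q (dilog_coeff q) (x + a))
     - \<alpha> * (exp_ser q log_coeff x - exp_ser q log_coeff (x + a)))"
proof -
  note s = exp_ser_shift_diff[OF _ x a]
  show ?thesis
    using sums_diff[OF sums_add[OF s[OF powser_conv_gamma] s[OF powser_conv_dilog]]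
        sums_mult[OF s[OF powser_conv_log], of \<alpha>]]
    by (simp add: H_coeff_def algebra_simps)
qed

text \<open>Expanding \<open>1 - (q powr a) ^ k\<close> yields two power series, at \<open>y\<close>
  and at \<open>q powr a * y\<close>, both inside the unit disc.\<close>

lemma powser_conv_H:
  assumes a: "a > 0"
  shows "powser_conv (H_coeff q a \<alpha>)"
  unfolding powser_conv_def
proof (intro allI impI)
  fix y :: real assume y: "\<bar>y\<bar> < 1"
  have A: "0 \<le> q powr a" "q powr a < 1"
    using q_powr_less_one[OF a] by auto
  have y': "\<bar>q powr a * y\<bar> < 1"
    using mult_strict_mono'[of "q powr a" 1 "\<bar>y\<bar>" 1] A y by (simp add: abs_mult)
  define g where "g k = gamma_coeff q k + dilog_coeff q k - \<alpha> * log_coeff k" for k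
  have g: "summable (\<lambda>k. g k * z ^ k)" if "\<bar>z\<bar> < 1" for z
    using that powser_conv_gamma powser_conv_dilog powser_conv_cmult[OF powser_conv_log, of \<alpha>]
    unfolding g_def powser_conv_def left_diff_distrib distrib_right
    by (intro summable_diff summable_add) auto
  have "H_coeff q a \<alpha> k = (1 - (q powr a) ^ k) * g k" for k
    by (simp add: H_coeff_def g_def)
  then have "H_coeff q a \<alpha> k * y ^ k = g k * y ^ k - g k * (q powr a * y) ^ k" for k
    by (simp add: power_mult_distrib left_diff_distrib)
  then show "summable (\<lambda>k. H_coeff q a \<alpha> k * y ^ k)"
    using summable_diff[OF g[OF y] g[OF y']]
    by simp
qed

lemma H_eq_exp_ser:
  assumes x: "x > 0" and a: "a > 0"
  shows "H q a \<alpha> x = a * ln (1 - q) + exp_ser q (H_coeff q a \<alpha>) x"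
proof -
  have xa: "x + a > 0" using x a by simp
  have p: "0 < 1 - q powr x" "0 < 1 - q powr (x + a)"
    using q_powr_less_one[OF x] q_powr_less_one[OF xa] by auto
  let ?G = "exp_ser q (gamma_coeff q)" and ?S = "exp_ser q (dilog_coeff q)"
  \<comment> \<open>The exponents \<open>1 - x\<close> and \<open>1 - (x + a)\<close> differ by
    \<open>a\<close>, whence the constant; the normalising values at 1 cancel.\<close>
  have "q_Gamma q x / q_Gamma q (x + a) = exp (a * ln (1 - q) + ?G x - ?G (x + a))"
    unfolding q_Gamma_eq_exp[OF x] q_Gamma_eq_exp[OF xa] exp_diff[symmetric]
    by (simp add: algebra_simps)
  moreover have "((1 - q powr x) / (1 - q powr (x + a))) powr \<alpha>
     = exp (\<alpha> * (ln (1 - q powr x) - ln (1 - q powr (x + a))))"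
    using p by (simp add: powr_def ln_div)
  ultimately have H: "H q a \<alpha> x = \<alpha> * (ln (1 - q powr x) - ln (1 - q powr (x + a)))
      + (a * ln (1 - q) + ?G x - ?G (x + a)) + (?S x - ?S (x + a))"
    unfolding H_def dilog_series_eq[OF x a] by (simp flip: exp_add)
  have "exp_ser q (H_coeff q a \<alpha>) x = ?G x - ?G (x + a) + (?S x - ?S (x + a))
     - \<alpha> * (exp_ser q log_coeff x - exp_ser q log_coeff (x + a))"
    using H_coeff_sums[OF x a, of \<alpha>] by (simp add: exp_ser_def sums_iff)
  with H show ?thesis
    unfolding exp_ser_log[OF x] exp_ser_log[OF xa] by (simp add: right_diff_distrib)
qed

lemma H_has_derivative:
  assumes x: "x > 0" and a: "a > 0"
  shows "(H q a \<alpha> has_real_derivative exp_ser q (\<lambda>k. real k * ln q * H_coeff q a \<alpha> k) x) (at x)"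
proof (rule has_field_derivative_transform_within_open)
  show "((\<lambda>x. a * ln (1 - q) + exp_ser q (H_coeff q a \<alpha>) x) has_real_derivative
      exp_ser q (\<lambda>k. real k * ln q * H_coeff q a \<alpha> k) x) (at x)"
    using exp_ser_has_derivative[OF powser_conv_H[OF a] x, of \<alpha>]
    by (auto intro!: derivative_eq_intros)
  \<comment> \<open>The expansion is known only for positive arguments, so the derivative is
    transferred on the open half-line.\<close>
  show "open {0::real<..}" "x \<in> {0<..}" using x by auto
  show "a * ln (1 - q) + exp_ser q (H_coeff q a \<alpha>) y = H q a \<alpha> y" if "y \<in> {0<..}" for y
    using H_eq_exp_ser[of y a \<alpha>] a that by simp
qed

end

section \<open>Sign of the coefficients\<close>

text \<open>Clearing denominators turns the lower bound into \<open>f t \<ge> 0\<close>, where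
  \<open>f 0 = 0\<close>, and the upper bound into \<open>(1 + t) * exp (- t) \<le> 1\<close>. The
  latter inequality also makes the derivative of \<open>f\<close> nonnegative.\<close>

lemma inverse_one_minus_exp_bounds:
  fixes t :: real
  assumes t: "t > 0"
  shows "1 / 2 \<le> 1 / (1 - exp (- t)) - 1 / t" and "1 / (1 - exp (- t)) - 1 / t \<le> 1"
proof -
  have pos: "0 < 1 - exp (- t)" using t by simp
  have tangent: "(1 + s) * exp (- s) \<le> 1" for s :: real
    using mult_right_mono[OF exp_ge_add_one_self[of s], of "exp (- s)"] by (simp flip: exp_add)
  define f :: "real \<Rightarrow> real" where "f s = s - 2 + (s + 2) * exp (- s)" for s
  have "f 0 \<le> f t"
  proof (rule DERIV_nonneg_imp_nondecreasing[where f = f])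
    fix s
    have "(f has_real_derivative 1 - (1 + s) * exp (- s)) (at s)"
      unfolding f_def by (auto intro!: derivative_eq_intros simp: algebra_simps)
    then show "\<exists>y. (f has_real_derivative y) (at s) \<and> 0 \<le> y"
      using tangent[of s] by fastforce
  qed (use t in simp)
  then show "1 / 2 \<le> 1 / (1 - exp (- t)) - 1 / t"
    using t pos by (simp add: f_def field_simps)
  show "1 / (1 - exp (- t)) - 1 / t \<le> 1"
    using t pos tangent[of t] by (simp add: field_simps)
qed

lemma H_coeff_sign:
  fixes q a \<alpha> :: real
  assumes q: "0 < q" "q < 1" and a: "a > 0"
  shows "\<alpha> \<le> 1 / 2 \<Longrightarrow> 0 \<le> H_coeff q a \<alpha> k" and "1 \<le> \<alpha> \<Longrightarrow> H_coeff q a \<alpha> k \<le> 0"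
proof -
  \<comment> \<open>Both signs come from one factorisation of the coefficient into a nonnegative
    number times \<open>b\<close>.\<close>
  have "(\<alpha> \<le> 1 / 2 \<longrightarrow> 0 \<le> H_coeff q a \<alpha> k) \<and> (1 \<le> \<alpha> \<longrightarrow> H_coeff q a \<alpha> k \<le> 0)"
  proof (cases "k = 0")
    case True
    then show ?thesis by (simp add: H_coeff_def)
  next
    case False
    define t where "t = - (real k * ln q)"
    have t: "t > 0" unfolding t_def using q False by (simp add: mult_pos_neg)
    have et: "exp (- t) = q ^ k" using q by (simp add: t_def exp_of_nat_mult)
    define b where "b = 1 / (1 - exp (- t)) - 1 / t - \<alpha>"
    have "gamma_coeff q k + dilog_coeff q k - \<alpha> * log_coeff k = b / real k"
      using False unfolding gamma_coeff_def dilog_coeff_def log_coeff_def b_def et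
      unfolding t_def
      by (simp add: diff_divide_distrib add_divide_distrib power2_eq_square mult_ac)
    then have eq: "H_coeff q a \<alpha> k = (1 - (q powr a) ^ k) / real k * b"
      by (simp add: H_coeff_def)
    have "(q powr a) ^ k \<le> 1"
      using q_powr_less_one[OF q a] by (intro power_le_one) auto
    then have "0 \<le> (1 - (q powr a) ^ k) / real k" by simp
    moreover have "\<alpha> \<le> 1 / 2 \<longrightarrow> 0 \<le> b" "1 \<le> \<alpha> \<longrightarrow> b \<le> 0"
      using inverse_one_minus_exp_bounds[OF t] by (auto simp: b_def)
    ultimately show ?thesis
      unfolding eq using mult_nonneg_nonneg mult_nonneg_nonpos by blast
  qed
  then show "\<alpha> \<le> 1 / 2 \<Longrightarrow> 0 \<le> H_coeff q a \<alpha> k" "1 \<le> \<alpha> \<Longrightarrow> H_coeff q a \<alpha> k \<le> 0"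
    by auto
qed

theorem theorem2p3:
  fixes q a \<alpha> :: real
  assumes "0 < q" and "q < 1" and "a > 0"
  shows "(\<forall>x>0. H q a \<alpha> differentiable (at x)) \<and>
         (\<alpha> \<le> 1 / 2 \<longrightarrow> completely_monotonic_on {0<..} (\<lambda>x. - deriv (H q a \<alpha>) x)) \<and>
         (\<alpha> \<ge> 1 \<longrightarrow> completely_monotonic_on {0<..} (deriv (H q a \<alpha>)))"
proof -
  note q = assms(1,2) and a = assms(3)
  note D = H_has_derivative[OF q _ a, of _ \<alpha>]
  let ?d = "\<lambda>k. real k * ln q * H_coeff q a \<alpha> k"
  have conv: "powser_conv ?d"
    using powser_conv_power_mult[OF powser_conv_H[OF q a, of \<alpha>], of "ln q" 1] by simp
  \<comment> \<open>One differentiation reverses the sign of the coefficients, so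
    \<open>\<alpha> \<le> 1 / 2\<close> concerns the negated derivative and
    \<open>\<alpha> \<ge> 1\<close> the derivative itself.\<close>
  have nonpos: "real k * ln q \<le> 0" for k
    using q by (intro mult_nonneg_nonpos) auto
  have deriv: "deriv (H q a \<alpha>) x = exp_ser q ?d x" if "x > 0" for x
    by (rule DERIV_imp_deriv[OF D[OF that]])
  show ?thesis
  proof (intro conjI allI impI)
    \<comment> \<open>Differentiability ensures that \<open>deriv\<close>, defined by choice,
      denotes the true derivative.\<close>
    show "H q a \<alpha> differentiable (at x)" if "x > 0" for x
      using D[OF that] real_differentiable_def by blast
    show "completely_monotonic_on {0<..} (\<lambda>x. - deriv (H q a \<alpha>) x)" if "\<alpha> \<le> 1 / 2"
    proof (rule completely_monotonic_exp_ser[OF q])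
      show "powser_conv (\<lambda>k. - 1 * ?d k)"
        by (rule powser_conv_cmult[OF conv])
      show "0 \<le> - 1 * ?d k" for k
        using mult_nonpos_nonneg[OF nonpos H_coeff_sign(1)[OF q a that]] by simp
      show "- deriv (H q a \<alpha>) x = exp_ser q (\<lambda>k. - 1 * ?d k) x" if "x > 0" for x
        using sums_mult[OF exp_ser_sums[OF q conv that], of "- 1"] deriv[OF that]
        by (simp add: exp_ser_def sums_iff)
    qed
    show "completely_monotonic_on {0<..} (deriv (H q a \<alpha>))" if "\<alpha> \<ge> 1"
      by (rule completely_monotonic_exp_ser[OF q conv _ deriv])
        (rule mult_nonpos_nonpos[OF nonpos H_coeff_sign(2)[OF q a that]])
  qed
qed

end
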